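(* Let $G,H$ be bipartite graphs of order $n$, $e$ a cut edge of $G$, $e'$ a cut edge of $H$, and let $G(k)$, $H(k)$ be the $k$-subdivision graphs of $G$ on $e$ and of $H$ on $e'$. Write $g_k=\widetilde{\phi}(G(k),x)$ and $h_k=\widetilde{\phi}(H(k),x)$. (1) If $h_1g_0-h_0g_1>0$ for all $x>0$, then $\mathbb{E}(H(k))-\mathbb{E}(G(k))>\mathbb{E}(H(0))-\mathbb{E}(G(0))$ for all $k>0$. (2) If $h_1g_0-h_0g_1<0$ for all $x>0$, then $\mathbb{E}(H(k))-\mathbb{E}(G(k))>\mathbb{E}(H(1))-\mathbb{E}(G(1))$ for all $k\ne 1$.
   Context: The energy $\mathbb{E}(G)$ is the sum of absolute values of the adjacency eigenvalues of $G$. For a graph $G$ of order $n$, $\phi(G,x)=\det(xI-A(G))=\sum_{i=0}^n a_i(G)x^{n-i}$ and $\widetilde{\phi}(G,x)=\sum_{i=0}^n |a_i(G)|x^{n-i}$. For a cut edge $e$ of $G$, the $k$-subdivision graph $G(k)$ on $e$ is obtained by replacing $e$ with a path of length $k+1$; $G(0)=G$. *)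

theory Defs
  imports
    "Graph_Theory.Graph_Theory"
    "Jordan_Normal_Form.Spectral_Radius"
begin

text \<open>
  Finite simple graphs are rendered by the locale \<^locale>\<open>pair_graph\<close>: finite, symmetric and
  loop-free sets of vertex pairs. An undirected edge between \<open>u\<close> and \<open>v\<close> is the pair of opposite
  arcs \<open>(u, v)\<close> and \<open>(v, u)\<close> and is named by either one of them.
\<close>

definition bipartite :: "'a pair_pre_digraph \<Rightarrow> bool" where
  "bipartite G \<longleftrightarrow> (\<exists>X Y. X \<union> Y = pverts G \<and> X \<inter> Y = {} \<and> parcs G \<subseteq> X \<times> Y \<union> Y \<times> X)"

definition delete_edge :: "'a pair_pre_digraph \<Rightarrow> 'a \<times> 'a \<Rightarrow> 'a pair_pre_digraph" where
  "delete_edge G e = \<lparr> pverts = pverts G, parcs = parcs G - {e, prod.swap e} \<rparr>"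

text \<open>
  In a symmetric digraph the strongly connected components \<^const>\<open>pre_digraph.sccs\<close> are the
  connected components of the underlying undirected graph.
\<close>

definition cut_edge :: "'a pair_pre_digraph \<Rightarrow> 'a \<times> 'a \<Rightarrow> bool" where
  "cut_edge G e \<longleftrightarrow> e \<in> parcs G \<and>
     card (pre_digraph.sccs (with_proj G)) < card (pre_digraph.sccs (with_proj (delete_edge G e)))"

definition path_arcs :: "'a list \<Rightarrow> ('a \<times> 'a) set" where
  "path_arcs xs = (\<Union>i\<in>{i. Suc i < length xs}. {(xs ! i, xs ! Suc i), (xs ! Suc i, xs ! i)})"

text \<open>
  Old vertices are tagged by \<^const>\<open>Inl\<close>; \<open>Inr 0, \<dots>, Inr (k - 1)\<close> are the inner vertices of the
  new path, which therefore has \<open>k + 1\<close> edges. Naming the edge by the opposite arc only reverses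
  the numbering of the inner vertices.
\<close>

definition k_subdivision :: "'a pair_pre_digraph \<Rightarrow> 'a \<times> 'a \<Rightarrow> nat \<Rightarrow> ('a + nat) pair_pre_digraph" where
  "k_subdivision G e k =
     \<lparr> pverts = Inl ` pverts G \<union> Inr ` {..<k},
       parcs = map_prod Inl Inl ` (parcs G - {e, prod.swap e})
             \<union> path_arcs (Inl (fst e) # map Inr [0..<k] @ [Inl (snd e)]) \<rparr>"

definition adjacency_matrix_wrt :: "'a list \<Rightarrow> 'a pair_pre_digraph \<Rightarrow> real mat" where
  "adjacency_matrix_wrt vs G =
     mat (length vs) (length vs) (\<lambda>(i, j). if (vs ! i, vs ! j) \<in> parcs G then 1 else 0)"

text \<open>
  The adjacency matrix depends on an enumeration of the vertices, of which an arbitrary one is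
  chosen; its characteristic polynomial does not depend on the choice
  (lemma \<open>char_poly_adjacency_matrix_wrt\<close> below).
\<close>

definition adjacency_matrix :: "'a pair_pre_digraph \<Rightarrow> real mat" where
  "adjacency_matrix G = adjacency_matrix_wrt (SOME vs. distinct vs \<and> set vs = pverts G) G"

definition graph_char_poly :: "'a pair_pre_digraph \<Rightarrow> real poly" where
  "graph_char_poly G = char_poly (adjacency_matrix G)"

definition abs_char_poly :: "'a pair_pre_digraph \<Rightarrow> real poly" where
  "abs_char_poly G = map_poly abs (graph_char_poly G)"

text \<open>
  Eigenvalues are counted with their (algebraic) multiplicities. Since the matrix is real and
  symmetric, all its eigenvalues are real.
\<close>

definition energy :: "'a pair_pre_digraph \<Rightarrow> real" where
  "energy G = (\<Sum>\<mu>\<in>spectrum (adjacency_matrix G).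
     real (order \<mu> (graph_char_poly G)) * \<bar>\<mu>\<bar>)"


lemma det_permute_rows_cols:
  assumes A: "A \<in> carrier_mat n n" and p: "p permutes {0..<n}"
  shows "det (mat n n (\<lambda>(i, j). A $$ (p i, p j))) = det A"
proof -
  let ?B = "mat n n (\<lambda>(i, j). A $$ (p i, j))"
  have lt: "p i < n" if "i < n" for i
    using permutes_in_image[OF p, of i] that by simp
  have "mat n n (\<lambda>(i, j). A $$ (p i, p j)) =
      transpose_mat (mat n n (\<lambda>(i, j). transpose_mat ?B $$ (p i, j)))"
    by (rule eq_matI) (auto simp: lt)
  then have "det (mat n n (\<lambda>(i, j). A $$ (p i, p j))) =
      det (mat n n (\<lambda>(i, j). transpose_mat ?B $$ (p i, j)))"
    by (simp add: det_transpose[of _ n])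
  also have "\<dots> = signof p * det (transpose_mat ?B)"
    by (rule det_permute_rows[OF _ p]) simp
  also have "det (transpose_mat ?B) = signof p * det A"
    using det_permute_rows[OF A p] by (simp add: det_transpose[of _ n])
  finally show ?thesis
    by (simp add: sign_def)
qed

lemma char_poly_adjacency_matrix_wrt_cong:
  assumes "distinct xs" "distinct ys" "set xs = set ys"
  shows "char_poly (adjacency_matrix_wrt xs G) = char_poly (adjacency_matrix_wrt ys G)"
proof -
  have "mset xs = mset ys"
    using assms by (simp add: set_eq_iff_mset_eq_distinct)
  then obtain p where p: "p permutes {..<length ys}" and xs: "permute_list p ys = xs"
    using mset_eq_permutation by metis
  let ?n = "length ys"
  let ?C = "char_poly_matrix (adjacency_matrix_wrt ys G)"
  have len: "length xs = ?n"
    using xs by auto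
  have lt: "p i < ?n" if "i < ?n" for i
    using permutes_in_image[OF p, of i] that by simp
  have inj: "p i = p j \<longleftrightarrow> i = j" for i j
    using permutes_inj[OF p] by (auto dest: injD)
  have nth: "xs ! i = ys ! p i" if "i < ?n" for i
    using permute_list_nth[OF p that] xs by simp
  have "char_poly_matrix (adjacency_matrix_wrt xs G) = mat ?n ?n (\<lambda>(i, j). ?C $$ (p i, p j))"
    by (rule eq_matI) (auto simp: char_poly_matrix_def adjacency_matrix_wrt_def len lt nth inj)
  moreover have "?C \<in> carrier_mat ?n ?n"
    by (simp add: adjacency_matrix_wrt_def)
  ultimately show ?thesis
    using p by (simp add: char_poly_def det_permute_rows_cols atLeast0LessThan)
qed

lemma char_poly_adjacency_matrix_wrt:
  assumes "distinct vs" "set vs = pverts G"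
  shows "char_poly (adjacency_matrix_wrt vs G) = graph_char_poly G"
proof -
  let ?ws = "SOME vs. distinct vs \<and> set vs = pverts G"
  have "distinct ?ws \<and> set ?ws = pverts G"
    by (rule someI[of _ vs]) (use assms in simp)
  then show ?thesis
    unfolding graph_char_poly_def adjacency_matrix_def
    using assms by (intro char_poly_adjacency_matrix_wrt_cong) auto
qed

lemma k_subdivision_0:
  assumes "pair_graph G" "e \<in> parcs G"
  shows "k_subdivision G e 0 =
    \<lparr> pverts = Inl ` pverts G, parcs = map_prod Inl Inl ` parcs G \<rparr>"
proof -
  interpret pair_graph G by fact
  obtain u v where e: "e = (u, v)" by (cases e)
  have "(v, u) \<in> parcs G"
    using arcs_symmetric assms(2) e by blast
  then show ?thesis
    using assms(2) by (auto simp: k_subdivision_def path_arcs_def e image_iff)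
qed

text \<open>The 0-subdivision is a relabelled copy of the graph itself.\<close>

lemma graph_char_poly_k_subdivision_0:
  assumes "pair_graph G" "e \<in> parcs G"
  shows "graph_char_poly (k_subdivision G e 0) = graph_char_poly G"
proof -
  interpret pair_graph G by fact
  obtain vs where vs: "distinct vs" "set vs = pverts G"
    using finite_distinct_list[OF pair_finite_verts] by blast
  have inl: "(Inl a, Inl b) \<in> map_prod Inl Inl ` parcs G \<longleftrightarrow> (a, b) \<in> parcs G" for a b
    by force
  have "graph_char_poly (k_subdivision G e 0) =
      char_poly (adjacency_matrix_wrt (map Inl vs) (k_subdivision G e 0))"
    by (rule char_poly_adjacency_matrix_wrt[symmetric])
      (simp_all add: k_subdivision_0[OF assms] vs distinct_map)
  also have "adjacency_matrix_wrt (map Inl vs) (k_subdivision G e 0) = adjacency_matrix_wrt vs G"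
    by (rule eq_matI) (auto simp: adjacency_matrix_wrt_def k_subdivision_0[OF assms] inl)
  finally show ?thesis
    using char_poly_adjacency_matrix_wrt[OF vs] by simp
qed

lemma spectrum_adjacency_matrix:
  "spectrum (adjacency_matrix G) = {\<mu>. poly (graph_char_poly G) \<mu> = 0}"
  unfolding graph_char_poly_def adjacency_matrix_def adjacency_matrix_wrt_def
  by (rule spectrum_root_char_poly[OF mat_carrier])

lemma energy_k_subdivision_0:
  assumes "pair_graph G" "e \<in> parcs G"
  shows "energy (k_subdivision G e 0) = energy G"
  by (simp add: energy_def spectrum_adjacency_matrix graph_char_poly_k_subdivision_0[OF assms])

end

theory Submission
  imports Defs "HOL-Real_Asymp.Real_Asymp"
begin

text \<open>
  Expanding along the new path gives \<open>\<phi>(G(k+2)) = x \<phi>(G(k+1)) - \<phi>(G(k))\<close> because the subdivided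
  edge is a bridge. For a bipartite graph of order \<open>m\<close> the spectrum is symmetric, so that
  \<open>\<phi>(\<i>x) = \<i>\<^sup>m \<phi>'(x)\<close> for the polynomial \<open>\<phi>'\<close> of absolute values; hence \<open>g\<^sub>k\<^sub>+\<^sub>2 = x g\<^sub>k\<^sub>+\<^sub>1 + g\<^sub>k\<close>, and
  the determinants \<open>h\<^sub>k g\<^sub>j - h\<^sub>j g\<^sub>k\<close> satisfy the same recurrence in \<open>k\<close>, which propagates their sign on
  \<open>x > 0\<close> from the two initial values.

  Since \<open>\<phi>'(x)\<^sup>2\<close> is the product of \<open>x\<^sup>2 + \<lambda>\<^sup>2\<close> over the eigenvalues, \<open>h\<^sub>k g\<^sub>j > h\<^sub>j g\<^sub>k\<close> compares two such
  products with equally many factors. Integrating logarithms over \<open>(0, \<infinity>)\<close>, where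
  \<open>ln (1 + \<lambda>\<^sup>2 / x\<^sup>2)\<close> contributes \<open>\<pi> |\<lambda>|\<close>, turns this into the inequality of energies.
\<close>

section \<open>Logarithmic integrals and sums of absolute values\<close>

text \<open>
  The function below is the antiderivative of \<open>ln (1 + a\<^sup>2 / x\<^sup>2)\<close> that vanishes at \<open>0\<close>. It replaces
  the Coulson--Jacobs integral formula for differences of energies; at \<open>a = 0\<close> the junk value
  \<open>x / 0 = 0\<close> is harmless.
\<close>

lemma energy_kernel_deriv:
  fixes a x :: real
  assumes "x > 0"
  shows "((\<lambda>x. x * ln (1 + a\<^sup>2 / x\<^sup>2) + 2 * a * arctan (x / a)) has_real_derivative ln (1 + a\<^sup>2 / x\<^sup>2)) (at x)"
proof (cases "a = 0")
  case True
  then show ?thesis by simp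
next
  case False
  have pos: "1 + a\<^sup>2 / x\<^sup>2 > 0"
    by (simp add: add_pos_nonneg)
  have nz: "x\<^sup>2 + a\<^sup>2 \<noteq> 0"
    using assms by (simp add: sum_power2_eq_zero_iff)
  have inner: "((\<lambda>x. 1 + a\<^sup>2 / x\<^sup>2) has_real_derivative - 2 * a\<^sup>2 / x ^ 3) (at x)"
    using assms
    by (auto intro!: derivative_eq_intros, simp add: field_simps power2_eq_square power3_eq_cube power4_eq_xxxx)
  have scaled: "((\<lambda>x. x / a) has_real_derivative 1 / a) (at x)"
    using DERIV_cdivide[OF DERIV_ident] .
  have "((\<lambda>x. x * ln (1 + a\<^sup>2 / x\<^sup>2) + 2 * a * arctan (x / a)) has_real_derivative
      (ln (1 + a\<^sup>2 / x\<^sup>2) + x * ((- 2 * a\<^sup>2 / x ^ 3) / (1 + a\<^sup>2 / x\<^sup>2)) + 2 * a * ((1 / a) / (1 + (x / a)\<^sup>2)))) (at x)"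
    using DERIV_add[OF DERIV_mult[OF DERIV_ident DERIV_chain2[OF DERIV_ln[OF pos] inner]]
      DERIV_cmult[OF DERIV_chain2[OF DERIV_arctan scaled], of "2 * a"]]
    by (simp add: divide_inverse algebra_simps)
  also have "x * ((- 2 * a\<^sup>2 / x ^ 3) / (1 + a\<^sup>2 / x\<^sup>2)) = - 2 * a\<^sup>2 / (x\<^sup>2 + a\<^sup>2)"
    using assms pos nz by (simp add: divide_simps power2_eq_square power3_eq_cube)
  also have "2 * a * ((1 / a) / (1 + (x / a)\<^sup>2)) = 2 * a\<^sup>2 / (x\<^sup>2 + a\<^sup>2)"
    using nz False by (simp add: divide_simps power2_eq_square)
  finally show ?thesis
    by simp
qed

lemma energy_kernel_at_right_0:
  fixes a :: real
  assumes "a \<ge> 0"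
  shows "((\<lambda>x. x * ln (1 + a\<^sup>2 / x\<^sup>2) + 2 * a * arctan (x / a)) \<longlongrightarrow> 0) (at_right 0)"
proof (cases "a = 0")
  case False
  with assms have "a > 0" by simp
  then show ?thesis by real_asymp
qed simp

text \<open>The logarithmic term decays like \<open>a\<^sup>2 / x\<close>, so only
  \<open>2 * a * (pi / 2)\<close> survives; the sign of \<open>a\<close> decides which limit
  \<open>arctan\<close> takes.\<close>

lemma energy_kernel_at_top:
  fixes a :: real
  assumes "a \<ge> 0"
  shows "((\<lambda>x. x * ln (1 + a\<^sup>2 / x\<^sup>2) + 2 * a * arctan (x / a)) \<longlongrightarrow> pi * a) at_top"
proof (cases "a = 0")
  case False
  with assms have "a > 0" by simp
  then show ?thesis by real_asymp
qed simp

lemma tendsto_sum_mset: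
  fixes f :: "'c \<Rightarrow> 'b \<Rightarrow> real"
  assumes "\<And>r. r \<in># M \<Longrightarrow> (f r \<longlongrightarrow> l r) F"
  shows "((\<lambda>x. \<Sum>r\<in>#M. f r x) \<longlongrightarrow> (\<Sum>r\<in>#M. l r)) F"
  using assms by (induction M) (auto intro!: tendsto_intros)

lemma has_real_derivative_sum_mset:
  fixes f :: "'c \<Rightarrow> real \<Rightarrow> real"
  assumes "\<And>r. r \<in># M \<Longrightarrow> (f r has_real_derivative d r) F"
  shows "((\<lambda>x. \<Sum>r\<in>#M. f r x) has_real_derivative (\<Sum>r\<in>#M. d r)) F"
  using assms by (induction M) (auto intro!: derivative_intros)

text \<open>Positivity of the product is carried through the same induction because the logarithm
  splits only over positive factors.\<close>

lemma ln_prod_mset: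
  fixes f :: "'c \<Rightarrow> real"
  assumes "\<And>r. r \<in># M \<Longrightarrow> f r > 0"
  shows "ln (\<Prod>r\<in>#M. f r) = (\<Sum>r\<in>#M. ln (f r)) \<and> (\<Prod>r\<in>#M. f r) > 0"
  using assms by (induction M) (auto simp: ln_mult_pos)

text \<open>Each factor gives up one \<open>x\<^sup>2\<close>. For multisets of equal size the
  extracted powers agree and cancel. The absolute value matches the kernel, whose limits are stated
  for a nonnegative parameter.\<close>

lemma prod_mset_scale:
  fixes x :: real
  assumes "x > 0"
  shows "(\<Prod>r\<in>#M. x\<^sup>2 + r\<^sup>2) = x ^ (2 * size M) * (\<Prod>r\<in>#M. 1 + \<bar>r\<bar>\<^sup>2 / x\<^sup>2)"
proof (induction M)
  case (add r M)
  have "x\<^sup>2 + r\<^sup>2 = x\<^sup>2 * (1 + \<bar>r\<bar>\<^sup>2 / x\<^sup>2)"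
    using assms by (simp add: distrib_left)
  with add show ?case
    by (simp add: power_add mult_ac power2_eq_square)
qed simp

text \<open>The difference \<open>F\<close> of the summed kernels has as derivative the logarithm of
  the quotient of the scaled products, which is positive. So \<open>F\<close> increases from its
  limit 0 at the left end to \<open>pi\<close> times the difference of the two sums.\<close>

lemma sum_abs_less:
  fixes M N :: "real multiset"
  assumes size: "size M = size N"
    and less: "\<And>x. x > 0 \<Longrightarrow> (\<Prod>r\<in>#N. x\<^sup>2 + r\<^sup>2) < (\<Prod>r\<in>#M. x\<^sup>2 + r\<^sup>2)"
  shows "(\<Sum>r\<in>#N. \<bar>r\<bar>) < (\<Sum>r\<in>#M. \<bar>r\<bar>)"
proof -
  define k where "k a x = x * ln (1 + a\<^sup>2 / x\<^sup>2) + 2 * a * arctan (x / a)" for a x :: real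
  define K where "K L x = (\<Sum>r\<in>#L. k \<bar>r\<bar> x)" for L and x :: real
  define F where "F x = K M x - K N x" for x
  have deriv: "(K L has_real_derivative ln (\<Prod>r\<in>#L. 1 + \<bar>r\<bar>\<^sup>2 / x\<^sup>2)) (at x)" if "x > 0" for L x
  proof -
    have "ln (\<Prod>r\<in>#L. 1 + \<bar>r\<bar>\<^sup>2 / x\<^sup>2) = (\<Sum>r\<in>#L. ln (1 + \<bar>r\<bar>\<^sup>2 / x\<^sup>2))"
      by (rule ln_prod_mset[THEN conjunct1]) (simp add: add_pos_nonneg)
    then show ?thesis
      unfolding K_def k_def
      by (simp only:) (rule has_real_derivative_sum_mset, rule energy_kernel_deriv[OF that])
  qed
  have pos: "(\<Prod>r\<in>#L. 1 + \<bar>r\<bar>\<^sup>2 / x\<^sup>2) > 0" for L and x :: real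
    by (rule ln_prod_mset[THEN conjunct2]) (simp add: add_pos_nonneg)
  have incr: "\<exists>d>0. (F has_real_derivative d) (at x)" if "x > 0" for x
  proof (intro exI conjI)
    show "(F has_real_derivative
        ln (\<Prod>r\<in>#M. 1 + \<bar>r\<bar>\<^sup>2 / x\<^sup>2) - ln (\<Prod>r\<in>#N. 1 + \<bar>r\<bar>\<^sup>2 / x\<^sup>2)) (at x)"
      unfolding F_def by (intro derivative_intros deriv that)
    have "(\<Prod>r\<in>#N. 1 + \<bar>r\<bar>\<^sup>2 / x\<^sup>2) < (\<Prod>r\<in>#M. 1 + \<bar>r\<bar>\<^sup>2 / x\<^sup>2)"
      using less[OF that] that unfolding prod_mset_scale[OF that] size by simp
    then show "ln (\<Prod>r\<in>#M. 1 + \<bar>r\<bar>\<^sup>2 / x\<^sup>2) - ln (\<Prod>r\<in>#N. 1 + \<bar>r\<bar>\<^sup>2 / x\<^sup>2) > 0"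
      using pos by simp
  qed
  have mono: "F x < F y" if "0 < x" "x < y" for x y
  proof (rule DERIV_pos_imp_increasing[OF that(2)])
    fix z assume "x \<le> z" "z \<le> y"
    with that(1) have "0 < z" by simp
    then show "\<exists>d. DERIV F z :> d \<and> 0 < d" using incr by blast
  qed
  have lim0: "(F \<longlongrightarrow> 0) (at_right 0)"
  proof -
    have "(K L \<longlongrightarrow> (\<Sum>r\<in>#L. 0)) (at_right 0)" for L
      unfolding K_def k_def by (intro tendsto_sum_mset energy_kernel_at_right_0) simp
    from tendsto_diff[OF this[of M] this[of N]] show ?thesis
      by (simp add: F_def[abs_def])
  qed
  have lim1: "(F \<longlongrightarrow> pi * ((\<Sum>r\<in>#M. \<bar>r\<bar>) - (\<Sum>r\<in>#N. \<bar>r\<bar>))) at_top"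
  proof -
    have "(K L \<longlongrightarrow> (\<Sum>r\<in>#L. pi * \<bar>r\<bar>)) at_top" for L
      unfolding K_def k_def by (intro tendsto_sum_mset energy_kernel_at_top) simp
    from tendsto_diff[OF this[of M] this[of N]] show ?thesis
      unfolding F_def[abs_def] sum_mset_distrib_left[symmetric] right_diff_distrib .
  qed
  have "0 \<le> F 1"
  proof (rule tendsto_upperbound[OF lim0])
    show "\<forall>\<^sub>F x in at_right 0. F x \<le> F 1"
      using eventually_at_right_real[of 0 1] by (rule eventually_mono) (auto intro!: less_imp_le mono)
  qed simp
  \<comment> \<open>Limits yield only weak inequalities; strictness comes from two interior points,
    for which 1 and 2 are arbitrary choices.\<close>
  also have "F 1 < F 2"
    by (rule mono) auto
  also have "F 2 \<le> pi * ((\<Sum>r\<in>#M. \<bar>r\<bar>) - (\<Sum>r\<in>#N. \<bar>r\<bar>))"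
  proof (rule tendsto_lowerbound[OF lim1])
    show "\<forall>\<^sub>F x in at_top. F 2 \<le> F x"
      using eventually_gt_at_top[of 2] by (rule eventually_mono) (auto intro!: less_imp_le mono)
  qed simp
  finally show ?thesis
    by (simp add: zero_less_mult_iff)
qed

section \<open>Characteristic polynomials across a bridge\<close>

text \<open>Off the two diagonal blocks only the entries at \<open>(m, Suc m)\<close> and
  \<open>(Suc m, m)\<close> may be nonzero. Row \<open>m\<close> is expanded with the first of these
  entries split off: without it the matrix is block triangular, and its cofactor contributes the
  second product.\<close>

lemma det_bridge:
  fixes f :: "nat \<Rightarrow> nat \<Rightarrow> 'a::idom"
  assumes ur: "\<And>i j. i \<le> m \<Longrightarrow> m < j \<Longrightarrow> j \<le> Suc (m + l) \<Longrightarrow> (i, j) \<noteq> (m, Suc m) \<Longrightarrow> f i j = 0"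
    and ll: "\<And>i j. i \<le> m \<Longrightarrow> m < j \<Longrightarrow> j \<le> Suc (m + l) \<Longrightarrow> (i, j) \<noteq> (m, Suc m) \<Longrightarrow> f j i = 0"
  shows "det (mat (Suc m + Suc l) (Suc m + Suc l) (\<lambda>(i, j). f i j)) =
    det (mat (Suc m) (Suc m) (\<lambda>(i, j). f i j)) *
      det (mat (Suc l) (Suc l) (\<lambda>(i, j). f (Suc m + i) (Suc m + j)))
    - f m (Suc m) * f (Suc m) m * (det (mat m m (\<lambda>(i, j). f i j)) *
      det (mat l l (\<lambda>(i, j). f (Suc (Suc m) + i) (Suc (Suc m) + j))))"
proof -
  let ?n = "Suc m + Suc l"
  define N where "N = mat ?n ?n (\<lambda>(i, j). f i j)"
  define N0 where "N0 = mat ?n ?n (\<lambda>(i, j). if i = m \<and> j = Suc m then 0 else f i j)"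
  have carrier: "N \<in> carrier_mat ?n ?n" "N0 \<in> carrier_mat ?n ?n"
    by (simp_all add: N_def N0_def)
  \<comment> \<open>The two matrices differ only in row \<open>m\<close>, which is deleted
    here.\<close>
  have cof: "cofactor N0 m j = cofactor N m j" for j
  proof -
    have "mat_delete N0 m j = mat_delete N m j"
      by (rule eq_matI) (auto simp: mat_delete_def N_def N0_def)
    then show ?thesis by (simp add: cofactor_def)
  qed
  have "det N = (\<Sum>j<?n. N $$ (m, j) * cofactor N m j)"
    by (rule laplace_expansion_row[OF carrier(1)]) simp
  also have "\<dots> = (\<Sum>j<?n. N0 $$ (m, j) * cofactor N0 m j + (if j = Suc m then f m (Suc m) * cofactor N m j else 0))"
    by (rule sum.cong) (auto simp: cof, auto simp: N_def N0_def)
  also have "\<dots> = det N0 + f m (Suc m) * cofactor N m (Suc m)"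
    by (subst laplace_expansion_row[OF carrier(2), of m]) (simp_all add: sum.distrib)
  also have "det N0 = det (mat (Suc m) (Suc m) (\<lambda>(i, j). f i j)) *
      det (mat (Suc l) (Suc l) (\<lambda>(i, j). f (Suc m + i) (Suc m + j)))"
  proof -
    have "N0 = four_block_mat (mat (Suc m) (Suc m) (\<lambda>(i, j). f i j)) (0\<^sub>m (Suc m) (Suc l))
        (mat (Suc l) (Suc m) (\<lambda>(i, j). f (Suc m + i) j))
        (mat (Suc l) (Suc l) (\<lambda>(i, j). f (Suc m + i) (Suc m + j)))"
      by (rule eq_matI) (auto simp: N0_def four_block_mat_def Let_def ur)
    then show ?thesis
      by (simp only:) (rule det_four_block_mat_upper_right_zero, auto)
  qed
  also have "cofactor N m (Suc m) = - (f (Suc m) m * (det (mat m m (\<lambda>(i, j). f i j)) *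
      det (mat l l (\<lambda>(i, j). f (Suc (Suc m) + i) (Suc (Suc m) + j)))))"
  proof -
    let ?L = "four_block_mat (mat 1 1 (\<lambda>_. f (Suc m) m)) (mat 1 l (\<lambda>(i, j). f (Suc m) (Suc (Suc m) + j)))
        (0\<^sub>m l 1) (mat l l (\<lambda>(i, j). f (Suc (Suc m) + i) (Suc (Suc m) + j)))"
    have L: "?L \<in> carrier_mat (Suc l) (Suc l)"
      by auto
    \<comment> \<open>The old column \<open>m\<close> becomes the first column of the lower right
      block \<open>?L\<close>; there its only possibly nonzero entry is the corner
      \<open>f (Suc m) m\<close>. The sign of the cofactor is that of an odd index sum.\<close>
    have "mat_delete N m (Suc m) = four_block_mat (mat m m (\<lambda>(i, j). f i j))
        (mat m (Suc l) (\<lambda>(i, j). if j = 0 then f i m else 0)) (0\<^sub>m (Suc l) m) ?L"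
      by (rule eq_matI) (auto simp: mat_delete_def N_def four_block_mat_def Let_def  not_less, auto simp: N_def ur ll)
    then have "det (mat_delete N m (Suc m)) = det (mat m m (\<lambda>(i, j). f i j)) * det ?L"
      by (simp only:) (rule det_four_block_mat_lower_left_zero[OF _ _ _ L], auto)
    also have "det ?L = f (Suc m) m * det (mat l l (\<lambda>(i, j). f (Suc (Suc m) + i) (Suc (Suc m) + j)))"
      by (subst det_four_block_mat_lower_left_zero_col) (auto simp: det_single)
    finally show ?thesis
      by (simp add: cofactor_def mult_ac)
  qed
  finally show ?thesis
    by (simp add: N_def mult.assoc)
qed

lemma char_poly_adjacency_matrix_wrt_det:
  "char_poly (adjacency_matrix_wrt vs G) = det (mat (length vs) (length vs)
    (\<lambda>(i, j). (if i = j then [:0, 1:] else 0) + (if (vs ! i, vs ! j) \<in> parcs G then -1 else 0)))"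
  unfolding char_poly_def
  by (rule arg_cong[of _ _ det], rule eq_matI)
    (auto simp: char_poly_matrix_def adjacency_matrix_wrt_def one_pCons)

lemma char_poly_adjacency_matrix_wrt_Nil:
  "char_poly (adjacency_matrix_wrt [] G) = 1"
  by (simp add: char_poly_adjacency_matrix_wrt_det)

lemma char_poly_adjacency_matrix_wrt_single:
  "(a, a) \<notin> parcs G \<Longrightarrow> char_poly (adjacency_matrix_wrt [a] G) = [:0, 1:]"
  by (simp add: char_poly_adjacency_matrix_wrt_det det_single)

lemma adjacency_matrix_wrt_cong:
  assumes "\<And>a b. a \<in> set vs \<Longrightarrow> b \<in> set vs \<Longrightarrow> (a, b) \<in> parcs G \<longleftrightarrow> (a, b) \<in> parcs H"
  shows "adjacency_matrix_wrt vs G = adjacency_matrix_wrt vs H"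
  by (rule eq_matI) (auto simp: adjacency_matrix_wrt_def assms)

text \<open>The classical bridge formula: the product over the two sides minus the product over the
  sides with the ends of the bridge removed. Listing \<open>a\<close> last on its side and
  \<open>b\<close> first on the other puts the bridge at the corner of the blocks, as
  \<open>det_bridge\<close> requires.\<close>

lemma char_poly_bridge:
  assumes dist: "distinct (xs @ a # b # ys)"
    and arcs: "(a, b) \<in> parcs G" "(b, a) \<in> parcs G"
    and bridge: "\<And>p q. p \<in> insert a (set xs) \<Longrightarrow> q \<in> insert b (set ys) \<Longrightarrow>
      (p, q) \<in> parcs G \<or> (q, p) \<in> parcs G \<Longrightarrow> p = a \<and> q = b"
  shows "char_poly (adjacency_matrix_wrt (xs @ a # b # ys) G) =
    char_poly (adjacency_matrix_wrt (xs @ [a]) G) * char_poly (adjacency_matrix_wrt (b # ys) G)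
    - char_poly (adjacency_matrix_wrt xs G) * char_poly (adjacency_matrix_wrt ys G)"
proof -
  let ?vs = "xs @ a # b # ys"
  let ?m = "length xs" and ?l = "length ys"
  let ?c = "\<lambda>vs i j. (if i = j then [:0, 1:] else 0) + (if (vs ! i, vs ! j) \<in> parcs G then -1 else 0) :: real poly"
  have off: "(?vs ! i, ?vs ! j) \<notin> parcs G \<and> (?vs ! j, ?vs ! i) \<notin> parcs G"
    if range: "i \<le> ?m" "?m < j" "j \<le> Suc (?m + ?l)" "(i, j) \<noteq> (?m, Suc ?m)" for i j
  proof
    have "i = ?m \<or> i < ?m" using that by linarith
    then have i: "?vs ! i \<in> insert a (set xs)"
      by (auto simp: nth_append)
    obtain j' where j': "j = Suc ?m + j'"
      using range(2) less_imp_Suc_add by force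
    then have j: "?vs ! j \<in> insert b (set ys)"
      using range by (cases j') (auto simp: nth_append)
    have "?vs ! ?m = a" "?vs ! Suc ?m = b"
      by (auto simp: nth_append)
    then have "\<not> (?vs ! i = a \<and> ?vs ! j = b)"
      using that nth_eq_iff_index_eq[OF dist, of i ?m] nth_eq_iff_index_eq[OF dist, of j "Suc ?m"]
      by auto
    with bridge[OF i j] show "(?vs ! i, ?vs ! j) \<notin> parcs G" "(?vs ! j, ?vs ! i) \<notin> parcs G"
      by blast+
  qed
  \<comment> \<open>All four minors are windows of consecutive positions, starting at
    \<open>d\<close>, in the list of vertices.\<close>
  have sub: "det (mat k k (\<lambda>(i, j). ?c ?vs (d + i) (d + j))) = char_poly (adjacency_matrix_wrt vs G)"
    if "k = length vs" "\<And>i. i < k \<Longrightarrow> ?vs ! (d + i) = vs ! i" for k d vs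
    unfolding char_poly_adjacency_matrix_wrt_det that(1)[symmetric]
    by (rule arg_cong[of _ _ det], rule eq_matI) (auto simp: that(2))
  have "char_poly (adjacency_matrix_wrt ?vs G) =
      det (mat (Suc ?m + Suc ?l) (Suc ?m + Suc ?l) (\<lambda>(i, j). ?c ?vs i j))"
    by (simp add: char_poly_adjacency_matrix_wrt_det)
  also have "\<dots> = det (mat (Suc ?m) (Suc ?m) (\<lambda>(i, j). ?c ?vs i j)) *
        det (mat (Suc ?l) (Suc ?l) (\<lambda>(i, j). ?c ?vs (Suc ?m + i) (Suc ?m + j)))
      - ?c ?vs ?m (Suc ?m) * ?c ?vs (Suc ?m) ?m * (det (mat ?m ?m (\<lambda>(i, j). ?c ?vs i j)) *
        det (mat ?l ?l (\<lambda>(i, j). ?c ?vs (Suc (Suc ?m) + i) (Suc (Suc ?m) + j))))"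
    by (rule det_bridge) (use off in auto)
  also have "?c ?vs ?m (Suc ?m) * ?c ?vs (Suc ?m) ?m = 1"
    using arcs by (simp add: nth_append)
  also have "det (mat (Suc ?m) (Suc ?m) (\<lambda>(i, j). ?c ?vs i j)) = char_poly (adjacency_matrix_wrt (xs @ [a]) G)"
    by (rule sub[where d = 0, unfolded add_0]) (auto simp: nth_append less_Suc_eq)
  also have "det (mat (Suc ?l) (Suc ?l) (\<lambda>(i, j). ?c ?vs (Suc ?m + i) (Suc ?m + j))) =
      char_poly (adjacency_matrix_wrt (b # ys) G)"
    by (rule sub) (auto simp: nth_append)
  also have "det (mat ?m ?m (\<lambda>(i, j). ?c ?vs i j)) = char_poly (adjacency_matrix_wrt xs G)"
    by (rule sub[where d = 0, unfolded add_0]) (auto simp: nth_append)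
  also have "det (mat ?l ?l (\<lambda>(i, j). ?c ?vs (Suc (Suc ?m) + i) (Suc (Suc ?m) + j))) =
      char_poly (adjacency_matrix_wrt ys G)"
    by (rule sub) (auto simp: nth_append)
  finally show ?thesis
    by simp
qed

section \<open>Cut edges and connected components\<close>

text \<open>Reachability is confined to vertices, whereas the reflexive transitive closure relates
  everything to itself; hence the condition on \<open>a\<close>.\<close>

lemma (in pair_wf_digraph) reachable_iff_rtrancl:
  "a \<rightarrow>\<^sup>*\<^bsub>with_proj G\<^esub> b \<longleftrightarrow> a \<in> pverts G \<and> (a, b) \<in> (parcs G)\<^sup>*"
proof
  assume "a \<rightarrow>\<^sup>*\<^bsub>with_proj G\<^esub> b"
  then show "a \<in> pverts G \<and> (a, b) \<in> (parcs G)\<^sup>*"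
    using reachable_in_verts(1)[of a b] reachable_rtranclI[of "with_proj G" a b] by auto
next
  assume "a \<in> pverts G \<and> (a, b) \<in> (parcs G)\<^sup>*"
  then have "(a, b) \<in> (parcs G)\<^sup>*" "a \<in> pverts G" by auto
  then show "a \<rightarrow>\<^sup>*\<^bsub>with_proj G\<^esub> b"
    by (induction rule: rtrancl_induct) (auto intro: reachable_adj_trans)
qed

text \<open>The set \<open>A\<close> is the component of \<open>u\<close> after deletion of the
  edge. If it contained \<open>v\<close>, a detour would replace the deleted arcs, reachability
  would not change, and the number of components could not grow.\<close>

lemma cut_edge_separation:
  assumes G: "pair_graph G" and cut: "cut_edge G (u, v)"
  obtains A where "A \<subseteq> pverts G" "u \<in> A" "v \<in> pverts G" "v \<notin> A"
    "\<And>a b. (a, b) \<in> parcs G \<Longrightarrow> a \<in> A \<Longrightarrow> b \<notin> A \<Longrightarrow> a = u \<and> b = v"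
    "\<And>a b. (a, b) \<in> parcs G \<Longrightarrow> a \<notin> A \<Longrightarrow> b \<in> A \<Longrightarrow> a = v \<and> b = u"
proof -
  interpret G: pair_graph G by fact
  let ?M = "delete_edge G (u, v)"
  let ?A = "{w \<in> pverts G. (u, w) \<in> (parcs ?M)\<^sup>*}"
  have parcs_M: "parcs ?M = parcs G - {(u, v), (v, u)}" and pverts_M: "pverts ?M = pverts G"
    by (simp_all add: delete_edge_def)
  have sym_G: "(b, a) \<in> parcs G" if "(a, b) \<in> parcs G" for a b
    using G.arcs_symmetric that by blast
  interpret M: pair_graph ?M
  proof
    show "finite (pverts ?M)" "finite (parcs ?M)"
      by (simp_all add: parcs_M pverts_M)
    show "fst x \<in> pverts ?M" "snd x \<in> pverts ?M" "fst x \<noteq> snd x" if "x \<in> parcs ?M" for x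
      using that G.in_arcsD1[of "fst x" "snd x"] G.in_arcsD2[of "fst x" "snd x"] G.no_loops[of x]
      by (auto simp: parcs_M pverts_M)
    show "symmetric (with_proj ?M)"
      unfolding symmetric_def with_proj_simps by (rule symI) (auto simp: parcs_M sym_G)
  qed
  have uv: "(u, v) \<in> parcs G"
    using cut by (simp add: cut_edge_def)
  have uv_verts: "u \<in> pverts G" "v \<in> pverts G"
    using uv G.in_arcsD1 G.in_arcsD2 by auto
  have sym: "(b, a) \<in> (parcs ?M)\<^sup>*" if "(a, b) \<in> (parcs ?M)\<^sup>*" for a b
  proof -
    have "sym ((parcs ?M)\<^sup>*)"
      by (rule sym_rtrancl) (auto simp: sym_def parcs_M sym_G)
    with that show ?thesis by (auto dest: symD)
  qed
  have "v \<notin> ?A"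
  proof
    assume "v \<in> ?A"
    then have "(u, v) \<in> (parcs ?M)\<^sup>*" "(v, u) \<in> (parcs ?M)\<^sup>*"
      using sym by auto
    then have "parcs G \<subseteq> (parcs ?M)\<^sup>*"
      unfolding parcs_M by auto
    then have eq: "(parcs G)\<^sup>* = (parcs ?M)\<^sup>*"
      by (intro rtrancl_subset) (auto simp: parcs_M)
    have "a \<rightarrow>\<^sup>*\<^bsub>with_proj G\<^esub> b \<longleftrightarrow> a \<rightarrow>\<^sup>*\<^bsub>with_proj ?M\<^esub> b" for a b
      unfolding G.reachable_iff_rtrancl M.reachable_iff_rtrancl eq pverts_M ..
    then have "G.sccs_verts = M.sccs_verts"
      by (simp add: G.sccs_verts_def M.sccs_verts_def)
    then have "card G.sccs = card M.sccs"
      using G.card_sccs_verts M.card_sccs_verts by simp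
    with cut show False
      by (simp add: cut_edge_def)
  qed
  show ?thesis
  proof (rule that[of ?A])
    show "a = u \<and> b = v" if "(a, b) \<in> parcs G" "a \<in> ?A" "b \<notin> ?A" for a b
    proof (rule ccontr)
      assume "\<not> ?thesis"
      then have "(a, b) \<in> parcs ?M"
        using that \<open>v \<notin> ?A\<close> uv_verts by (auto simp: parcs_M)
      with that show False
        using G.in_arcsD2[of a b] by (auto intro: rtrancl_into_rtrancl)
    qed
    then show "a = v \<and> b = u" if "(a, b) \<in> parcs G" "a \<notin> ?A" "b \<in> ?A" for a b
      using that sym_G by blast
  qed (use uv_verts \<open>v \<notin> ?A\<close> in auto)
qed

section \<open>Arcs of the subdivided graph\<close>

lemma path_arcs_snoc:
  "path_arcs (xs @ [a, b]) = path_arcs (xs @ [a]) \<union> {(a, b), (b, a)}"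
proof -
  have "{i. Suc i < length (xs @ [a, b])} = insert (length xs) {i. Suc i < length (xs @ [a])}"
    by auto
  moreover have "(xs @ [a, b]) ! i = (xs @ [a]) ! i" if "i < length (xs @ [a])" for i
    using that by (auto simp: nth_append)
  ultimately show ?thesis
    unfolding path_arcs_def by (auto simp: nth_append)
qed

lemma doubleton_pairs_Suc:
  "{(x, y). \<exists>i<Suc k. {x, y} = {f i, g i}} = {(x, y). \<exists>i<k. {x, y} = {f i, g i}} \<union> {(f k, g k), (g k, f k)}"
  by (auto simp: less_Suc_eq doubleton_eq_iff)

text \<open>Edge \<open>i\<close> ends at \<open>Inr i\<close> and starts at the preceding vertex,
  which for \<open>i = 0\<close> is the old vertex \<open>u\<close>. An equation between unordered
  pairs covers both arcs of an edge.\<close>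

lemma path_arcs_ray:
  "path_arcs (Inl u # map Inr [0..<k]) =
    {(x, y). \<exists>i<k. {x, y} = {if i = 0 then Inl u else Inr (i - 1), Inr i}}"
proof (induction k)
  case 0
  then show ?case by (simp add: path_arcs_def)
next
  case (Suc k)
  have "path_arcs (Inl u # map Inr [0..<Suc k]) =
      path_arcs (Inl u # map Inr [0..<k]) \<union>
      {(if k = 0 then Inl u else Inr (k - 1), Inr k), (Inr k, if k = 0 then Inl u else Inr (k - 1))}"
  proof (cases k)
    case 0
    then show ?thesis
      using path_arcs_snoc[of "[]" "Inl u" "Inr 0"] by simp
  next
    case (Suc m)
    then show ?thesis
      using path_arcs_snoc[of "Inl u # map Inr [0..<m]" "Inr m" "Inr k"] by simp
  qed
  then show ?case
    unfolding Suc.IH doubleton_pairs_Suc .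
qed

text \<open>The path is the ray from \<open>u\<close> closed by one last edge to \<open>v\<close>.
  For \<open>k = 0\<close> this last edge is the original one.\<close>

lemma parcs_k_subdivision:
  "parcs (k_subdivision G (u, v) k) = map_prod Inl Inl ` (parcs G - {(u, v), (v, u)}) \<union>
    {(x, y). \<exists>i<k. {x, y} = {if i = 0 then Inl u else Inr (i - 1), Inr i}} \<union>
    {(x, y). {x, y} = {if k = 0 then Inl u else Inr (k - 1), Inl v}}"
proof -
  have "path_arcs (Inl u # map Inr [0..<k] @ [Inl v]) = path_arcs (Inl u # map Inr [0..<k]) \<union>
      {(x, y). {x, y} = {if k = 0 then Inl u else Inr (k - 1), Inl v}}"
  proof (cases k)
    case 0
    then show ?thesis
      using path_arcs_snoc[of "[]" "Inl u" "Inl v"] by (auto simp: doubleton_eq_iff)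
  next
    case (Suc m)
    then show ?thesis
      using path_arcs_snoc[of "Inl u # map Inr [0..<m]" "Inr m" "Inl v"] by (auto simp: doubleton_eq_iff)
  qed
  then show ?thesis
    by (auto simp: k_subdivision_def path_arcs_ray)
qed

lemma map_prod_Inl_image_iff:
  "(Inl a, Inl b) \<in> map_prod Inl Inl ` S \<longleftrightarrow> (a, b) \<in> S"
  "(x, Inr j) \<notin> map_prod Inl Inl ` S"
  "(Inr i, x) \<notin> map_prod Inl Inl ` S"
  by (force, auto)

text \<open>Sorting by tags gives the form in which the later case analyses use the arcs;
  \<open>Suc i = k\<close> singles out the inner vertex next to \<open>v\<close>.\<close>

lemma k_subdivision_arcs:
  "(Inl a, Inl b) \<in> parcs (k_subdivision G (u, v) k) \<longleftrightarrow>
    (a, b) \<in> parcs G - {(u, v), (v, u)} \<or> k = 0 \<and> (a, b) \<in> {(u, v), (v, u)}"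
  "(Inl a, Inr i) \<in> parcs (k_subdivision G (u, v) k) \<longleftrightarrow> i < k \<and> (a = u \<and> i = 0 \<or> a = v \<and> Suc i = k)"
  "(Inr i, Inl a) \<in> parcs (k_subdivision G (u, v) k) \<longleftrightarrow> i < k \<and> (a = u \<and> i = 0 \<or> a = v \<and> Suc i = k)"
  "(Inr i, Inr j) \<in> parcs (k_subdivision G (u, v) k) \<longleftrightarrow> i < k \<and> j < k \<and> (j = Suc i \<or> i = Suc j)"
  unfolding parcs_k_subdivision Un_iff mem_Collect_eq split map_prod_Inl_image_iff doubleton_eq_iff
  by (auto split: if_splits)

lemma sym_k_subdivision:
  assumes "pair_graph G"
  shows "(x, y) \<in> parcs (k_subdivision G (u, v) k) \<longleftrightarrow> (y, x) \<in> parcs (k_subdivision G (u, v) k)"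
proof -
  interpret pair_graph G by fact
  show ?thesis
  proof (cases x)
    case x: (Inl a)
    show ?thesis
    proof (cases y)
      case (Inl b)
      have "(a, b) \<in> parcs G \<longleftrightarrow> (b, a) \<in> parcs G"
        using arcs_symmetric by blast
      with x Inl show ?thesis
        by (auto simp: k_subdivision_arcs)
    qed (use x in \<open>simp add: k_subdivision_arcs\<close>)
  next
    case (Inr i)
    then show ?thesis
      by (cases y) (auto simp: k_subdivision_arcs)
  qed
qed

lemma card_pverts_k_subdivision:
  fixes G :: "'a pair_pre_digraph"
  assumes "finite (pverts G)"
  shows "finite (pverts (k_subdivision G e k))"
    "card (pverts (k_subdivision G e k)) = card (pverts G) + k"
proof -
  show "finite (pverts (k_subdivision G e k))"
    using assms by (simp add: k_subdivision_def)
  have "card (Inl ` pverts G \<union> Inr ` {..<k}) =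
      card (Inl ` pverts G :: ('a + nat) set) + card (Inr ` {..<k} :: ('a + nat) set)"
    by (rule card_Un_disjoint) (use assms in auto)
  then show "card (pverts (k_subdivision G e k)) = card (pverts G) + k"
    by (simp add: k_subdivision_def card_image)
qed

section \<open>The recurrence for characteristic polynomials\<close>

text \<open>Cutting at the path edge incident with \<open>v\<close> expresses the polynomial
  linearly through \<open>p\<close>, the polynomials of the side of \<open>u\<close> with a growing
  tail, with coefficients \<open>q\<close> and \<open>q'\<close> independent of \<open>k\<close>.
  The recurrence is thus inherited from \<open>p\<close>, where it is the bridge formula for a
  pendant edge.\<close>

lemma graph_char_poly_k_subdivision_rec:
  assumes G: "pair_graph G" and cut: "cut_edge G (u, v)"
  shows "graph_char_poly (k_subdivision G (u, v) (Suc (Suc k))) =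
    [:0, 1:] * graph_char_poly (k_subdivision G (u, v) (Suc k)) - graph_char_poly (k_subdivision G (u, v) k)"
proof -
  interpret pair_graph G by fact
  obtain A where A: "A \<subseteq> pverts G" "u \<in> A" "v \<in> pverts G" "v \<notin> A"
    and A_out: "\<And>a b. (a, b) \<in> parcs G \<Longrightarrow> a \<in> A \<Longrightarrow> b \<notin> A \<Longrightarrow> a = u \<and> b = v"
    and A_in: "\<And>a b. (a, b) \<in> parcs G \<Longrightarrow> a \<notin> A \<Longrightarrow> b \<in> A \<Longrightarrow> a = v \<and> b = u"
    using cut_edge_separation[OF G cut] by blast
  have "finite A"
    using A(1) pair_finite_verts by (rule finite_subset)
  then obtain as where as: "distinct as" "set as = A - {u}"
    using finite_distinct_list[of "A - {u}"] by auto
  obtain bs where bs: "distinct bs" "set bs = pverts G - A - {v}"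
    using finite_distinct_list[of "pverts G - A - {v}"] pair_finite_verts by auto
  have uv: "(u, v) \<in> parcs G" "(v, u) \<in> parcs G"
    using cut arcs_symmetric by (auto simp: cut_edge_def)
  have loop: "(a, a) \<notin> parcs G" for a
    using pair_no_loops[of "(a, a)"] by auto
  let ?D = "\<lambda>vs G. char_poly (adjacency_matrix_wrt vs G)"
  let ?S = "k_subdivision G (u, v)"
  \<comment> \<open>The end at \<open>u\<close> with an infinite ray attached: it contains the relevant parts of all \<open>?S k\<close> at once.\<close>
  define R :: "('a + nat) pair_pre_digraph" where "R = \<lparr>pverts = UNIV,
    parcs = map_prod Inl Inl ` (parcs G - {(u, v), (v, u)}) \<union>
      {(x, y). \<exists>i. {x, y} = {if i = 0 then Inl u else Inr (i - 1), Inr i}}\<rparr>"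
  have R_arcs: "(Inl a, Inl b) \<in> parcs R \<longleftrightarrow> (a, b) \<in> parcs G - {(u, v), (v, u)}"
    "(Inl a, Inr i) \<in> parcs R \<longleftrightarrow> a = u \<and> i = 0"
    "(Inr i, Inl a) \<in> parcs R \<longleftrightarrow> a = u \<and> i = 0"
    "(Inr i, Inr j) \<in> parcs R \<longleftrightarrow> j = Suc i \<or> i = Suc j" for a b and i j :: nat
    unfolding R_def pair_pre_digraph.simps Un_iff mem_Collect_eq split map_prod_Inl_image_iff doubleton_eq_iff
    by (auto split: if_splits)
  define xs ys :: "('a + nat) list" where "xs = map Inl as" and "ys = map Inl bs"
  have set_xs: "set xs = Inl ` (A - {u})" and dist_xs: "distinct xs"
    using as by (auto simp: xs_def distinct_map)
  have set_ys: "set ys = Inl ` (pverts G - A - {v})" and dist_ys: "distinct ys"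
    using bs by (auto simp: ys_def distinct_map)
  \<comment> \<open>The tail stands at the end of the list, so that its last vertex is in the
    position of \<open>a\<close> in \<open>char_poly_bridge\<close>.\<close>
  define L where "L k = xs @ Inl u # map Inr [0..<k]" for k :: nat
  have L_Suc: "L (Suc k) = L k @ [Inr k]" for k
    by (simp add: L_def)
  have set_L: "set (L k) = Inl ` A \<union> Inr ` {..<k}" for k
    using A by (auto simp: L_def set_xs)
  have dist_L: "distinct (L k)" for k
    using dist_xs set_xs by (auto simp: L_def distinct_map)
  define p where "p k = ?D (L k) R" for k
  \<comment> \<open>With \<open>u\<close> itself removed, \<open>r\<close> plays the part of
    \<open>p\<close> at index -1.\<close>
  define r where "r = ?D xs R"
  define q where "q = ?D (Inl v # ys) R"
  define q' where "q' = ?D ys R"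
  have p_1: "p 1 = [:0, 1:] * p 0 - r"
  proof -
    have "?D (xs @ Inl u # Inr 0 # []) R =
        ?D (xs @ [Inl u]) R * ?D [Inr 0] R - ?D xs R * ?D [] R"
    proof (rule char_poly_bridge)
      show "distinct (xs @ Inl u # Inr 0 # [])"
        using dist_L[of 1] by (simp add: L_def)
      fix x y assume "x \<in> insert (Inl u) (set xs)" "y \<in> insert (Inr 0) (set [])"
        and arc: "(x, y) \<in> parcs R \<or> (y, x) \<in> parcs R"
      then obtain a where "x = Inl a" "y = Inr 0"
        by (auto simp: set_xs)
      with arc show "x = Inl u \<and> y = Inr 0"
        by (simp add: R_arcs)
    qed (simp_all add: R_arcs)
    then show ?thesis
      by (simp add: p_def L_def r_def char_poly_adjacency_matrix_wrt_Nil
        char_poly_adjacency_matrix_wrt_single R_arcs)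
  qed
  have p_rec: "p (Suc (Suc k)) = [:0, 1:] * p (Suc k) - p k" for k
  proof -
    have "?D (L k @ Inr k # Inr (Suc k) # []) R =
        ?D (L k @ [Inr k]) R * ?D [Inr (Suc k)] R - ?D (L k) R * ?D [] R"
    proof (rule char_poly_bridge)
      show "distinct (L k @ Inr k # Inr (Suc k) # [])"
        using dist_L[of "Suc (Suc k)"] by (simp add: L_Suc)
      fix x y assume x: "x \<in> insert (Inr k) (set (L k))" and "y \<in> insert (Inr (Suc k)) (set [])"
        and arc: "(x, y) \<in> parcs R \<or> (y, x) \<in> parcs R"
      then have y: "y = Inr (Suc k)"
        by simp
      show "x = Inr k \<and> y = Inr (Suc k)"
      proof (cases x)
        case (Inl a)
        with arc y show ?thesis
          by (simp add: R_arcs)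
      next
        case (Inr i)
        with x have "i \<le> k"
          by (auto simp: set_L)
        with arc Inr y show ?thesis
          by (auto simp: R_arcs)
      qed
    qed (simp_all add: R_arcs)
    then show ?thesis
      by (simp add: p_def L_Suc char_poly_adjacency_matrix_wrt_Nil
        char_poly_adjacency_matrix_wrt_single R_arcs)
  qed
  have c_0: "graph_char_poly (?S 0) = p 0 * q - r * q'"
  proof -
    have "graph_char_poly (?S 0) = ?D (xs @ Inl u # Inl v # ys) (?S 0)"
      by (rule char_poly_adjacency_matrix_wrt[symmetric])
        (use dist_xs dist_ys A in \<open>auto simp: k_subdivision_def set_xs set_ys\<close>)
    also have "\<dots> = ?D (xs @ [Inl u]) (?S 0) * ?D (Inl v # ys) (?S 0) - ?D xs (?S 0) * ?D ys (?S 0)"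
    proof (rule char_poly_bridge)
      show "distinct (xs @ Inl u # Inl v # ys)"
        using dist_xs dist_ys A by (auto simp: set_xs set_ys)
      fix x y assume "x \<in> insert (Inl u) (set xs)" "y \<in> insert (Inl v) (set ys)"
        and arc: "(x, y) \<in> parcs (?S 0) \<or> (y, x) \<in> parcs (?S 0)"
      then obtain a b where ab: "x = Inl a" "y = Inl b" "a \<in> A" "b \<notin> A"
        using A by (auto simp: set_xs set_ys)
      with arc have "(a, b) \<in> parcs G \<or> (b, a) \<in> parcs G \<or> (a, b) = (u, v) \<or> (a, b) = (v, u)"
        by (simp only: k_subdivision_arcs) blast
      then have "a = u \<and> b = v"
        using A_out[of a b] A_in[of b a] A ab by blast
      with ab show "x = Inl u \<and> y = Inl v"
        by simp
    qed (simp_all add: k_subdivision_arcs)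
    \<comment> \<open>Within either side of the cut, the subdivision and \<open>R\<close> have the
      same arcs; only the bridge between the sides distinguishes them.\<close>
    also have "adjacency_matrix_wrt (xs @ [Inl u]) (?S 0) = adjacency_matrix_wrt (L 0) R"
      unfolding L_def by (simp, rule adjacency_matrix_wrt_cong)
        (use A in \<open>auto simp: set_xs R_arcs k_subdivision_arcs\<close>)
    also have "adjacency_matrix_wrt (Inl v # ys) (?S 0) = adjacency_matrix_wrt (Inl v # ys) R"
      by (rule adjacency_matrix_wrt_cong)
        (use A in \<open>auto simp: set_ys R_arcs k_subdivision_arcs\<close>)
    also have "adjacency_matrix_wrt xs (?S 0) = adjacency_matrix_wrt xs R"
      by (rule adjacency_matrix_wrt_cong)
        (use A in \<open>auto simp: set_xs R_arcs k_subdivision_arcs\<close>)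
    also have "adjacency_matrix_wrt ys (?S 0) = adjacency_matrix_wrt ys R"
      by (rule adjacency_matrix_wrt_cong)
        (use A in \<open>auto simp: set_ys R_arcs k_subdivision_arcs\<close>)
    finally show ?thesis
      by (simp add: p_def q_def q'_def r_def)
  qed
  have c_Suc: "graph_char_poly (?S (Suc k)) = p (Suc k) * q - p k * q'" for k
  proof -
    have "graph_char_poly (?S (Suc k)) = ?D (L k @ Inr k # Inl v # ys) (?S (Suc k))"
      by (rule char_poly_adjacency_matrix_wrt[symmetric])
        (use dist_L[of k] dist_ys A in \<open>auto simp: k_subdivision_def set_L set_ys less_Suc_eq\<close>)
    also have "\<dots> = ?D (L k @ [Inr k]) (?S (Suc k)) * ?D (Inl v # ys) (?S (Suc k)) -
        ?D (L k) (?S (Suc k)) * ?D ys (?S (Suc k))"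
    proof (rule char_poly_bridge)
      show "distinct (L k @ Inr k # Inl v # ys)"
        using dist_L[of k] dist_ys A by (auto simp: set_ys set_L)
      fix x y assume xy: "x \<in> insert (Inr k) (set (L k))" "y \<in> insert (Inl v) (set ys)"
        and arc: "(x, y) \<in> parcs (?S (Suc k)) \<or> (y, x) \<in> parcs (?S (Suc k))"
      then obtain b where b: "y = Inl b" "b \<notin> A"
        using A by (auto simp: set_ys)
      show "x = Inr k \<and> y = Inl v"
      proof (cases x)
        case (Inl a)
        then have "a \<in> A" using xy A(2) by (auto simp: set_L)
        moreover have "(a, b) \<in> parcs G - {(u, v), (v, u)} \<or> (b, a) \<in> parcs G - {(u, v), (v, u)}"
          using arc Inl b(1) by (simp add: k_subdivision_arcs)
        ultimately show ?thesis
          using b(2) A_out[of a b] A_in[of b a] by blast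
      next
        case (Inr i)
        then show ?thesis
          using arc b A by (auto simp: k_subdivision_arcs)
      qed
    qed (simp_all add: k_subdivision_arcs)
    also have "adjacency_matrix_wrt (L k @ [Inr k]) (?S (Suc k)) = adjacency_matrix_wrt (L (Suc k)) R"
      unfolding L_Suc[symmetric] by (rule adjacency_matrix_wrt_cong)
        (use A in \<open>auto simp: R_arcs k_subdivision_arcs set_L\<close>)
    also have "adjacency_matrix_wrt (Inl v # ys) (?S (Suc k)) = adjacency_matrix_wrt (Inl v # ys) R"
      by (rule adjacency_matrix_wrt_cong) (use A in \<open>auto simp: R_arcs k_subdivision_arcs set_ys\<close>)
    also have "adjacency_matrix_wrt (L k) (?S (Suc k)) = adjacency_matrix_wrt (L k) R"
      by (rule adjacency_matrix_wrt_cong) (use A in \<open>auto simp: R_arcs k_subdivision_arcs set_L\<close>)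
    also have "adjacency_matrix_wrt ys (?S (Suc k)) = adjacency_matrix_wrt ys R"
      by (rule adjacency_matrix_wrt_cong) (use A in \<open>auto simp: R_arcs k_subdivision_arcs set_ys\<close>)
    finally show ?thesis
      by (simp add: p_def q_def q'_def)
  qed
  \<comment> \<open>With the variable kept opaque, both cases are plain ring identities in
    \<open>p\<close>, \<open>q\<close>, \<open>q'\<close> and \<open>r\<close>.\<close>
  define z where "z = [:0, 1 :: real:]"
  show ?thesis
  proof (cases k)
    case 0
    then show ?thesis
      unfolding 0 c_0 c_Suc p_rec[of 0] p_1[unfolded One_nat_def] z_def[symmetric]
      by (simp add: algebra_simps)
  next
    case (Suc m)
    then show ?thesis
      unfolding Suc c_Suc p_rec[of "Suc m"] p_rec[of m] z_def[symmetric]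
      by (simp add: algebra_simps)
  qed
qed

section \<open>Two-colourings of the subdivisions\<close>

text \<open>Subdividing an edge of a cycle could create an odd cycle. A cut edge lies on no cycle,
  so one side of it can be recoloured as a whole to suit the parity of the path.\<close>

lemma k_subdivision_colouring:
  assumes G: "pair_graph G" and bip: "bipartite G" and cut: "cut_edge G (u, v)"
  obtains c :: "'a + nat \<Rightarrow> bool"
    where "\<And>x y. (x, y) \<in> parcs (k_subdivision G (u, v) k) \<Longrightarrow> c x \<noteq> c y"
proof -
  interpret pair_graph G by fact
  obtain A where "A \<subseteq> pverts G" and A: "u \<in> A" and "v \<in> pverts G" and A': "v \<notin> A"
    and A_out: "\<And>a b. (a, b) \<in> parcs G \<Longrightarrow> a \<in> A \<Longrightarrow> b \<notin> A \<Longrightarrow> a = u \<and> b = v"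
    and A_in: "\<And>a b. (a, b) \<in> parcs G \<Longrightarrow> a \<notin> A \<Longrightarrow> b \<in> A \<Longrightarrow> a = v \<and> b = u"
    using cut_edge_separation[OF G cut] by blast
  obtain X Y where "X \<inter> Y = {}" "parcs G \<subseteq> X \<times> Y \<union> Y \<times> X"
    using bip unfolding bipartite_def by blast
  then have X: "a \<in> X \<longleftrightarrow> b \<notin> X" if "(a, b) \<in> parcs G" for a b
    using that by blast
  have uv: "(u, v) \<in> parcs G"
    using cut by (simp add: cut_edge_def)
  \<comment> \<open>For odd \<open>k\<close> the colours on the far side of the cut edge are exchanged.\<close>
  define c :: "'a + nat \<Rightarrow> bool" where "c x = (case x of Inl a \<Rightarrow> (a \<in> X) = (a \<in> A \<or> even k) | Inr i \<Rightarrow> (u \<in> X) = odd i)" for x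
  have c_Inl: "c (Inl a) \<noteq> c (Inl b)"
    if arc: "(a, b) \<in> parcs G - {(u, v), (v, u)} \<or> k = 0 \<and> (a, b) \<in> {(u, v), (v, u)}" for a b
  proof -
    have "(a \<in> X) \<noteq> (b \<in> X)"
      using arc X[of a b] X[OF uv] by auto
    moreover have "(a \<in> A \<or> even k) = (b \<in> A \<or> even k)"
    proof (cases "k = 0")
      case False
      with arc have "(a, b) \<in> parcs G" "\<not> (a = u \<and> b = v)" "\<not> (a = v \<and> b = u)"
        by auto
      then have "a \<in> A \<longleftrightarrow> b \<in> A"
        using A_out A_in by metis
      then show ?thesis by simp
    qed simp
    ultimately show ?thesis
      unfolding c_def sum.case by blast
  qed
  \<comment> \<open>The inner vertices alternate, starting opposite to \<open>u\<close>. The one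
    next to \<open>v\<close> has index \<open>k - 1\<close>, and the exchange for odd
    \<open>k\<close> gives \<open>v\<close> the other colour.\<close>
  have c_Inl_Inr: "c (Inl a) \<noteq> c (Inr i)" if "i < k" "a = u \<and> i = 0 \<or> a = v \<and> Suc i = k" for a i
    using that A A' X[OF uv] unfolding c_def by auto
  have c_Inr: "c (Inr i) \<noteq> c (Inr j)" if "j = Suc i \<or> i = Suc j" for i j
    using that unfolding c_def by auto
  have "c x \<noteq> c y" if arc: "(x, y) \<in> parcs (k_subdivision G (u, v) k)" for x y
  proof (cases x)
    case x: (Inl a)
    show ?thesis
    proof (cases y)
      case (Inl b)
      with x arc show ?thesis
        using c_Inl[of a b] by (auto simp: k_subdivision_arcs)
    next
      case (Inr i)
      with x arc show ?thesis
        using c_Inl_Inr[of i a] by (auto simp: k_subdivision_arcs)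
    qed
  next
    case x: (Inr i)
    show ?thesis
    proof (cases y)
      case (Inl b)
      with x arc show ?thesis
        using c_Inl_Inr[of i b] by (auto simp: k_subdivision_arcs)
    next
      case (Inr j)
      with x arc show ?thesis
        using c_Inr[of i j] by (auto simp: k_subdivision_arcs)
    qed
  qed
  then show ?thesis
    by (rule that)
qed

section \<open>Real spectra and the energy\<close>

lemma map_poly_of_real_mult:
  "map_poly complex_of_real (p * q) = map_poly complex_of_real p * map_poly complex_of_real q"
  by (rule poly_eqI) (simp add: coeff_map_poly coeff_mult)

lemma map_poly_of_real_add:
  "map_poly complex_of_real (p + q) = map_poly complex_of_real p + map_poly complex_of_real q"
  by (rule poly_eqI) (simp add: coeff_map_poly)

lemma map_poly_of_real_pCons:
  "map_poly complex_of_real (pCons a p) = pCons (of_real a) (map_poly complex_of_real p)"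
  by (rule poly_eqI) (simp add: coeff_map_poly coeff_pCons split: nat.split)

lemma map_poly_of_real_eq_iff:
  "map_poly complex_of_real p = map_poly complex_of_real q \<longleftrightarrow> p = q"
  by (auto simp: poly_eq_iff coeff_map_poly)

text \<open>The support of \<open>M\<close> changes during an induction; summing over a fixed finite
  superset, where absent elements count 0, keeps the index set constant.\<close>

lemma sum_mset_count:
  fixes f :: "'c \<Rightarrow> real"
  shows "(\<Sum>r\<in>#M. f r) = (\<Sum>r\<in>set_mset M. real (count M r) * f r)"
proof -
  have "(\<Sum>r\<in>set_mset M. real (count M r) * f r) = (\<Sum>r\<in>A. real (count M r) * f r)"
    if "finite A" "set_mset M \<subseteq> A" for A
    using that by (intro sum.mono_neutral_left) (auto simp: count_eq_zero_iff)
  moreover have "(\<Sum>r\<in>A. real (count M r) * f r) = (\<Sum>r\<in>#M. f r)" if "finite A" "set_mset M \<subseteq> A" for A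
    using that(2)
  proof (induction M)
    case (add r M)
    have "(\<Sum>s\<in>A. real (count (add_mset r M) s) * f s) =
        (\<Sum>s\<in>A. real (count M s) * f s + (if s = r then f r else 0))"
      by (intro sum.cong) (auto simp: algebra_simps)
    with add that(1) show ?case
      by (simp add: sum.distrib)
  qed simp
  ultimately show ?thesis
    by (metis finite_set_mset order_refl)
qed

text \<open>Moving the symmetric matrix across the Hermitian product of an eigenvector with itself
  yields that product once with the factor \<open>a\<close> and once with its conjugate.\<close>

lemma real_symmetric_eigenvalue_real:
  fixes A :: "real mat"
  assumes A: "A \<in> carrier_mat n n" and sym: "transpose_mat A = A"
    and ev: "eigenvalue (map_mat complex_of_real A) a"
  shows "a \<in> \<real>"
proof -
  let ?C = "map_mat complex_of_real A"
  have C: "?C \<in> carrier_mat n n"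
    using A by simp
  obtain v where v: "v \<in> carrier_vec n" "v \<noteq> 0\<^sub>v n" and Cv: "?C *\<^sub>v v = a \<cdot>\<^sub>v v"
    using ev C by (auto simp: eigenvalue_def eigenvector_def)
  \<comment> \<open>The entries are real, so conjugation commutes with the matrix.\<close>
  have "?C *\<^sub>v conjugate v = conjugate (?C *\<^sub>v v)"
    using A v(1) by (intro eq_vecI) (auto simp: scalar_prod_def sum_conjugate conjugate_dist_mul)
  then have Cv': "?C *\<^sub>v conjugate v = conjugate a \<cdot>\<^sub>v conjugate v"
    by (simp add: Cv conjugate_smult_vec)
  have "a * (v \<bullet>c v) = (?C *\<^sub>v v) \<bullet>c v"
    using v(1) by (simp add: Cv)
  also have "\<dots> = v \<bullet> (transpose_mat ?C *\<^sub>v conjugate v)"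
    using transpose_vec_mult_scalar[of "transpose_mat ?C" n n "conjugate v" v] C v(1) by simp
  also have "transpose_mat ?C = ?C"
  proof (rule eq_matI)
    fix i j assume "i < dim_row ?C" "j < dim_col ?C"
    then show "transpose_mat ?C $$ (i, j) = ?C $$ (i, j)"
      using A arg_cong[OF sym, of "\<lambda>B. B $$ (i, j)"] by simp
  qed (use A in auto)
  also have "v \<bullet> (?C *\<^sub>v conjugate v) = conjugate a * (v \<bullet>c v)"
    using v(1) by (simp add: Cv')
  finally have "a = cnj a"
    using conjugate_square_eq_0_vec[OF v(1)] v(2) by simp
  then show ?thesis
    by (simp add: Reals_cnj_iff)
qed

text \<open>The complex factorization has only real roots, so it is the image of a real one, and the
  embedding of real polynomials is injective.\<close>

lemma real_symmetric_char_poly_splits: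
  fixes A :: "real mat"
  assumes A: "A \<in> carrier_mat n n" and sym: "transpose_mat A = A"
  obtains M where "char_poly A = (\<Prod>r\<in>#M. [:- r, 1:])" "size M = n"
proof -
  let ?C = "map_mat complex_of_real A"
  have C: "?C \<in> carrier_mat n n"
    using A by simp
  obtain as where as: "char_poly ?C = (\<Prod>a\<leftarrow>as. [:- a, 1:])" "length as = n"
    using char_poly_factorized[OF C] by blast
  have "a \<in> \<real>" if "a \<in> set as" for a
  proof (rule real_symmetric_eigenvalue_real[OF A sym])
    have "poly (char_poly ?C) a = 0"
      using linear_poly_root[OF that] by (simp add: as)
    then show "eigenvalue ?C a"
      by (simp add: eigenvalue_root_char_poly[OF C])
  qed
  then have "(\<Prod>a\<leftarrow>as. [:- a, 1:]) = map_poly complex_of_real (\<Prod>a\<leftarrow>as. [:- Re a, 1:])"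
    by (induction as) (auto simp: map_poly_of_real_mult simp del: mult_pCons_left)
  then have "map_poly complex_of_real (char_poly A) = map_poly complex_of_real (\<Prod>a\<leftarrow>as. [:- Re a, 1:])"
    using as(1) by (simp only: of_real_hom.char_poly_hom[OF A, symmetric])
  then have "char_poly A = (\<Prod>a\<leftarrow>as. [:- Re a, 1:])"
    by (simp add: map_poly_of_real_eq_iff)
  then show ?thesis
    using that[of "mset (map Re as)"] as(2) 
    by (simp add: prod_mset_prod_list[symmetric] multiset.map_comp comp_def)
qed

lemma proots_prod_linear:
  "proots (\<Prod>r\<in>#M. [:- r, 1 :: 'a :: idom:]) = M"
proof (induction M)
  case (add r M)
  have "(\<Prod>r\<in>#M. [:- r, 1:]) \<noteq> 0"
    by (auto simp: prod_mset_zero_iff)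
  then have "proots ([:- r, 1:] * (\<Prod>r\<in>#M. [:- r, 1:])) = proots [:- r, 1:] + proots (\<Prod>r\<in>#M. [:- r, 1:])"
    by (intro proots_mult) auto
  with add show ?case
    by (simp del: mult_pCons_left)
qed simp

lemma energy_eq_sum_mset:
  assumes "graph_char_poly G = (\<Prod>r\<in>#M. [:- r, 1:])"
  shows "energy G = (\<Sum>r\<in>#M. \<bar>r\<bar>)"
proof -
  have nz: "graph_char_poly G \<noteq> 0"
    unfolding assms by (auto simp: prod_mset_zero_iff)
  have M: "proots (graph_char_poly G) = M"
    by (simp add: assms proots_prod_linear)
  then have "set_mset M = spectrum (adjacency_matrix G)"
    using nz by (auto simp: spectrum_adjacency_matrix)
  moreover have "order \<mu> (graph_char_poly G) = count M \<mu>" for \<mu>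
    using nz M by (metis count_proots)
  ultimately show ?thesis
    unfolding energy_def by (simp add: sum_mset_count)
qed

section \<open>Symmetric spectra and polynomials of absolute values\<close>

text \<open>Conjugation by the diagonal matrix \<open>S\<close> of colour signs fixes the diagonal
  and negates the entry of every arc, since the ends of an arc differ in colour. Hence
  \<open>N (- x)\<close> is minus the conjugate of \<open>N x\<close>.\<close>

lemma char_poly_bipartite_reflect:
  fixes c :: "'a \<Rightarrow> bool"
  assumes col: "\<And>a b. a \<in> set vs \<Longrightarrow> b \<in> set vs \<Longrightarrow> (a, b) \<in> parcs G \<Longrightarrow> c a \<noteq> c b"
  shows "poly (char_poly (adjacency_matrix_wrt vs G)) (- x) =
    (-1) ^ length vs * poly (char_poly (adjacency_matrix_wrt vs G)) x"
proof -
  let ?n = "length vs"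
  define N where "N x = mat ?n ?n (\<lambda>(i, j). (if i = j then x else 0) -
    (if (vs ! i, vs ! j) \<in> parcs G then 1 else 0))" for x :: real
  define S where "S = mat_diag ?n (\<lambda>i. if c (vs ! i) then 1 else - 1 :: real)"
  have char: "poly (char_poly (adjacency_matrix_wrt vs G)) x = det (N x)" for x
    unfolding char_poly_def
    by (rule poly_det_cong[of _ ?n]) (auto simp: N_def char_poly_matrix_def adjacency_matrix_wrt_def)
  have carrier: "S \<in> carrier_mat ?n ?n" "N x \<in> carrier_mat ?n ?n"
    by (auto simp: S_def N_def)
  have "det S * det S = det (S * S)"
    using carrier by (simp add: det_mult)
  also have "S * S = 1\<^sub>m ?n"
    unfolding S_def mat_diag_diag by (rule eq_matI) (auto simp: mat_diag_def)
  finally have S: "det S * det S = 1"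
    by simp
  have no_arc: "(vs ! i, vs ! j) \<notin> parcs G"
    if "i < ?n" "j < ?n" "c (vs ! i) = c (vs ! j)" for i j
    using col[of "vs ! i" "vs ! j"] that by auto
  have "N (- x) = (-1) \<cdot>\<^sub>m (S * N x * S)"
    unfolding S_def mat_diag_mult_left[OF carrier(2)]
    by (subst mat_diag_mult_right[of _ ?n]) (auto intro!: eq_matI simp: N_def no_arc)
  then have "det (N (- x)) = (-1) ^ ?n * (det S * det S) * det (N x)"
    using carrier by (simp add: det_smult det_mult[of _ ?n])
  then show ?thesis
    by (simp add: char S)
qed

text \<open>Negating all roots replaces a monic split polynomial by its reflection up to the sign
  assumed here. The two polynomials coincide, and so do their root multisets.\<close>

lemma mset_symmetric_of_poly_reflect:
  fixes M :: "real multiset"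
  assumes "\<And>x. poly (\<Prod>r\<in>#M. [:- r, 1:]) (- x) = (-1) ^ size M * poly (\<Prod>r\<in>#M. [:- r, 1:]) x"
  shows "image_mset uminus M = M"
proof -
  have "poly (\<Prod>r\<in>#image_mset uminus M. [:- r, 1:]) x = (-1) ^ size M * poly (\<Prod>r\<in>#M. [:- r, 1:]) (- x)" for x
    by (induction M) (auto simp: algebra_simps)
  then have "(\<Prod>r\<in>#image_mset uminus M. [:- r, 1:]) = (\<Prod>r\<in>#M. [:- r, 1:])"
    by (intro poly_ext) (simp add: assms)
  then show ?thesis
    by (metis proots_prod_linear)
qed

lemma coeff_mult_nonneg:
  fixes p q :: "real poly"
  assumes "\<And>k. coeff p k \<ge> 0" "\<And>k. coeff q k \<ge> 0"
  shows "coeff (p * q) k \<ge> 0"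
  unfolding coeff_mult by (intro sum_nonneg mult_nonneg_nonneg assms)

text \<open>Roots are removed singly if zero and otherwise in pairs \<open>r\<close>,
  \<open>- r\<close>. Under rotation the factor of a pair becomes \<open>\<i> * \<i>\<close> times
  \<open>x\<^sup>2 + r\<^sup>2\<close>, so what is left over is a product of polynomials with
  nonnegative coefficients.\<close>

lemma symmetric_roots_rotate:
  fixes M :: "real multiset"
  assumes "image_mset uminus M = M"
  shows "\<exists>q. (\<forall>k. coeff q k \<ge> 0) \<and>
    map_poly complex_of_real (\<Prod>r\<in>#M. [:- r, 1:]) \<circ>\<^sub>p [:0, \<i>:] =
      Polynomial.smult (\<i> ^ size M) (map_poly complex_of_real q)"
  using assms
proof (induction "size M" arbitrary: M rule: less_induct)
  case less
  show ?case
  proof (cases "M = {#}")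
    case True
    then show ?thesis by (intro exI[of _ 1]) (auto simp: pcompose_1)
  next
    case False
    then obtain r where r: "r \<in># M" by blast
    show ?thesis
    proof (cases "r = 0")
      case True
      then obtain N where M: "M = add_mset 0 N"
        using r by (metis insert_DiffM)
      then have "image_mset uminus N = N"
        using less.prems by simp
      then obtain q where q: "\<And>k. coeff q k \<ge> 0"
        "map_poly complex_of_real (\<Prod>r\<in>#N. [:- r, 1:]) \<circ>\<^sub>p [:0, \<i>:] =
          Polynomial.smult (\<i> ^ size N) (map_poly complex_of_real q)"
        using less.hyps[of N] M by auto
      show ?thesis
        using q(2) by (intro exI[of _ "[:0, 1:] * q"] conjI allI coeff_mult_nonneg q(1))
          (auto simp: M map_poly_of_real_mult pcompose_pCons map_poly_of_real_pCons mult.commute coeff_pCons split: nat.splits)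
    next
      case False
      \<comment> \<open>As \<open>r\<close> is nonzero, \<open>- r\<close> is a different element
        and both can be taken out of \<open>M\<close>.\<close>
      have "- r \<in># M"
        using r less.prems by (metis image_eqI set_image_mset)
      then obtain N where M: "M = add_mset r (add_mset (- r) N)"
        using r False by (metis insert_DiffM insert_noteq_member neg_equal_iff_equal equal_neg_zero)
      then have "image_mset uminus N = N"
        using less.prems by (simp add: add_mset_commute)
      then obtain q where q: "\<And>k. coeff q k \<ge> 0"
        "map_poly complex_of_real (\<Prod>r\<in>#N. [:- r, 1:]) \<circ>\<^sub>p [:0, \<i>:] =
          Polynomial.smult (\<i> ^ size N) (map_poly complex_of_real q)"
        using less.hyps[of N] M by auto
      let ?mp = "map_poly complex_of_real"
      have "(\<Prod>r\<in>#M. [:- r, 1:]) = ([:- r, 1:] * [:- (- r), 1:]) * (\<Prod>r\<in>#N. [:- r, 1:])"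
        by (simp only: M image_mset_add_mset prod_mset.add_mset mult.assoc)
      also have "[:- r, 1:] * [:- (- r), 1:] = [:- (r * r), 0, 1:]"
        by simp
      finally have "?mp (\<Prod>r\<in>#M. [:- r, 1:]) \<circ>\<^sub>p [:0, \<i>:] =
          (?mp [:- (r * r), 0, 1:] \<circ>\<^sub>p [:0, \<i>:]) * (?mp (\<Prod>r\<in>#N. [:- r, 1:]) \<circ>\<^sub>p [:0, \<i>:])"
        by (simp only: map_poly_of_real_mult pcompose_mult)
      also have "?mp [:- (r * r), 0, 1:] \<circ>\<^sub>p [:0, \<i>:] = Polynomial.smult (\<i> * \<i>) (?mp [:r * r, 0, 1:])"
        by (simp add: pcompose_pCons map_poly_of_real_pCons)
      finally have "?mp (\<Prod>r\<in>#M. [:- r, 1:]) \<circ>\<^sub>p [:0, \<i>:] =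
          Polynomial.smult (\<i> ^ size M) (?mp ([:r * r, 0, 1:] * q))"
        by (simp only: q(2) map_poly_of_real_mult M size_add_mset power_Suc mult_smult_left
            mult_smult_right smult_smult mult_ac)
      moreover have "coeff ([:r * r, 0, 1:] * q) k \<ge> 0" for k
        by (intro coeff_mult_nonneg q(1)) (simp add: coeff_pCons split: nat.split)
      ultimately show ?thesis
        by blast
    qed
  qed
qed

text \<open>Rotation multiplies each coefficient by a unit. Comparing norms identifies the
  nonnegative polynomial \<open>q\<close> of the preceding lemma with the polynomial of absolute
  values.\<close>

lemma poly_abs_rotate:
  fixes M :: "real multiset"
  assumes "image_mset uminus M = M"
  defines "p \<equiv> \<Prod>r\<in>#M. [:- r, 1:]"
  shows "poly (map_poly complex_of_real p) (\<i> * complex_of_real x) =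
    \<i> ^ size M * complex_of_real (poly (map_poly abs p) x)"
proof -
  obtain q where q: "\<And>k. coeff q k \<ge> 0"
    "map_poly complex_of_real p \<circ>\<^sub>p [:0, \<i>:] = Polynomial.smult (\<i> ^ size M) (map_poly complex_of_real q)"
    using symmetric_roots_rotate[OF assms(1)] unfolding p_def by blast
  have "\<bar>coeff p k\<bar> = coeff q k" for k
  proof -
    have "coeff (map_poly complex_of_real p \<circ>\<^sub>p [:0, \<i>:]) k = \<i> ^ size M * coeff q k"
      by (simp add: q(2) coeff_map_poly)
    then have "\<i> ^ k * coeff p k = \<i> ^ size M * coeff q k"
      by (simp add: coeff_pcompose_linear coeff_map_poly)
    from arg_cong[OF this, of norm] show ?thesis
      using q(1) by (simp add: norm_mult norm_power)
  qed
  then have "map_poly abs p = q"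
    by (intro poly_eqI) (simp add: coeff_map_poly)
  moreover have "poly (map_poly complex_of_real p \<circ>\<^sub>p [:0, \<i>:]) x = \<i> ^ size M * complex_of_real (poly q x)"
    unfolding q(2) by (simp add: of_real_hom.poly_map_poly)
  ultimately show ?thesis
    by (simp add: poly_pcompose mult.commute)
qed

text \<open>At the point \<open>\<i> * x\<close> each linear factor has squared modulus
  \<open>x\<^sup>2 + r\<^sup>2\<close>, and the power of \<open>\<i>\<close> from the rotation has
  modulus 1.\<close>

lemma poly_abs_squared:
  fixes M :: "real multiset"
  assumes "image_mset uminus M = M"
  shows "(poly (map_poly abs (\<Prod>r\<in>#M. [:- r, 1:])) x)\<^sup>2 = (\<Prod>r\<in>#M. x\<^sup>2 + r\<^sup>2)"
proof -
  have "(norm (poly (map_poly complex_of_real (\<Prod>r\<in>#M. [:- r, 1:])) (\<i> * complex_of_real x)))\<^sup>2 =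
      (\<Prod>r\<in>#M. x\<^sup>2 + r\<^sup>2)"
  proof (induction M)
    case (add r M)
    have "(norm (poly (map_poly complex_of_real [:- r, 1:]) (\<i> * complex_of_real x)))\<^sup>2 = x\<^sup>2 + r\<^sup>2"
      by (simp add: cmod_power2 map_poly_pCons)
    with add show ?case
      by (simp add: map_poly_of_real_mult norm_mult power_mult_distrib del: mult_pCons_left)
  qed simp
  then show ?thesis
    by (simp add: poly_abs_rotate[OF assms] norm_mult norm_power)
qed

lemma bipartite_spectrum:
  fixes c :: "'a \<Rightarrow> bool"
  assumes fin: "finite (pverts G)"
    and sym: "\<And>x y. (x, y) \<in> parcs G \<longleftrightarrow> (y, x) \<in> parcs G"
    and col: "\<And>x y. (x, y) \<in> parcs G \<Longrightarrow> c x \<noteq> c y"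
  obtains M where "graph_char_poly G = (\<Prod>r\<in>#M. [:- r, 1:])" "size M = card (pverts G)"
    "image_mset uminus M = M"
proof -
  obtain vs where vs: "distinct vs" "set vs = pverts G"
    using finite_distinct_list[OF fin] by blast
  let ?A = "adjacency_matrix_wrt vs G"
  have char: "graph_char_poly G = char_poly ?A"
    using char_poly_adjacency_matrix_wrt[OF vs] by simp
  have len: "length vs = card (pverts G)"
    using vs distinct_card by metis
  have A: "?A \<in> carrier_mat (length vs) (length vs)"
    by (simp add: adjacency_matrix_wrt_def)
  have "transpose_mat ?A = ?A"
    by (rule eq_matI) (auto simp: adjacency_matrix_wrt_def sym)
  then obtain M where M: "char_poly ?A = (\<Prod>r\<in>#M. [:- r, 1:])" "size M = length vs"
    using real_symmetric_char_poly_splits[OF A] by blast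
  have "image_mset uminus M = M"
  proof (rule mset_symmetric_of_poly_reflect)
    show "poly (\<Prod>r\<in>#M. [:- r, 1:]) (- x) = (-1) ^ size M * poly (\<Prod>r\<in>#M. [:- r, 1:]) x" for x
      unfolding M(1)[symmetric] M(2) by (rule char_poly_bipartite_reflect[of vs G c]) (rule col)
  qed
  with M show ?thesis
    using that char len by simp
qed

section \<open>Comparison of energies\<close>

lemma k_subdivision_spectra:
  assumes G: "pair_graph G" and bip: "bipartite G" and cut: "cut_edge G e"
  obtains M :: "nat \<Rightarrow> real multiset"
  where "\<And>k. size (M k) = card (pverts G) + k"
    "\<And>k. energy (k_subdivision G e k) = (\<Sum>r\<in>#M k. \<bar>r\<bar>)"
    "\<And>k x. (poly (abs_char_poly (k_subdivision G e k)) x)\<^sup>2 = (\<Prod>r\<in>#M k. x\<^sup>2 + r\<^sup>2)"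
    "\<And>k x. poly (abs_char_poly (k_subdivision G e (Suc (Suc k)))) x =
      x * poly (abs_char_poly (k_subdivision G e (Suc k))) x + poly (abs_char_poly (k_subdivision G e k)) x"
proof -
  interpret pair_graph G by fact
  obtain u v where e: "e = (u, v)" by (cases e)
  let ?S = "k_subdivision G e"
  have "\<exists>M. graph_char_poly (?S k) = (\<Prod>r\<in>#M. [:- r, 1:]) \<and> size M = card (pverts G) + k \<and>
      image_mset uminus M = M" for k
  proof -
    obtain c where "\<And>x y. (x, y) \<in> parcs (?S k) \<Longrightarrow> c x \<noteq> (c y :: bool)"
      using k_subdivision_colouring[OF G bip, of u v k] cut e by blast
    with card_pverts_k_subdivision[OF pair_finite_verts, of e k] sym_k_subdivision[OF G, of _ _ u v k]
    show ?thesis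
      using bipartite_spectrum[of "?S k" c] by (metis e)
  qed
  then obtain M where M: "\<And>k. graph_char_poly (?S k) = (\<Prod>r\<in>#M k. [:- r, 1:])"
    "\<And>k. size (M k) = card (pverts G) + k" "\<And>k. image_mset uminus (M k) = M k"
    by metis
  show ?thesis
  proof (rule that[of M])
    show "energy (?S k) = (\<Sum>r\<in>#M k. \<bar>r\<bar>)" for k
      by (rule energy_eq_sum_mset) (rule M(1))
    show "(poly (abs_char_poly (?S k)) x)\<^sup>2 = (\<Prod>r\<in>#M k. x\<^sup>2 + r\<^sup>2)" for k x
      unfolding abs_char_poly_def M(1) by (rule poly_abs_squared[OF M(3)])
    let ?p = "\<lambda>k. map_poly complex_of_real (graph_char_poly (?S k))"
    let ?n = "card (pverts G)"
    fix k x
    define a where "a j = poly (abs_char_poly (?S j)) x" for j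
    have rotate: "poly (?p j) (\<i> * complex_of_real x) = \<i> ^ (?n + j) * complex_of_real (a j)" for j
      unfolding a_def abs_char_poly_def M(1) M(2)[symmetric] by (rule poly_abs_rotate[OF M(3)])
    have "graph_char_poly (?S k) + graph_char_poly (?S (Suc (Suc k))) = [:0, 1:] * graph_char_poly (?S (Suc k))"
      using graph_char_poly_k_subdivision_rec[OF G, of u v k] cut e by simp
    then have "?p k + ?p (Suc (Suc k)) = [:0, 1:] * ?p (Suc k)"
      by (simp only: map_poly_of_real_add[symmetric] map_poly_of_real_mult) (simp add: map_poly_of_real_pCons)
    then have "poly (?p k) z + poly (?p (Suc (Suc k))) z = z * poly (?p (Suc k)) z" for z
      by (simp add: poly_add[symmetric] del: poly_add)
    \<comment> \<open>The term at \<open>Suc (Suc k)\<close> carries \<open>\<i> ^ 2\<close>, and so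
      does the right-hand side: one factor from the point of evaluation, one from the index
      \<open>Suc k\<close>. Cancelling \<open>\<i> ^ (?n + k)\<close> turns the minus sign of the
      recurrence into plus.\<close>
    from this[of "\<i> * complex_of_real x"]
    have "\<i> ^ (?n + k) * (complex_of_real (a k) - complex_of_real (a (Suc (Suc k)))) =
        \<i> ^ (?n + k) * (- complex_of_real (x * a (Suc k)))"
      unfolding rotate by (simp add: algebra_simps)
    then have "complex_of_real (a k) - complex_of_real (a (Suc (Suc k))) = - complex_of_real (x * a (Suc k))"
      by (subst (asm) mult_cancel_left) simp
    then have "complex_of_real (a (Suc (Suc k))) = complex_of_real (x * a (Suc k) + a k)"
      by (simp add: algebra_simps)
    then show "poly (abs_char_poly (?S (Suc (Suc k)))) x =
        x * poly (abs_char_poly (?S (Suc k))) x + poly (abs_char_poly (?S k)) x"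
      unfolding of_real_eq_iff a_def .
  qed (rule M(2))
qed

lemma poly_abs_char_poly_nonneg:
  assumes "x \<ge> 0"
  shows "poly (abs_char_poly G) x \<ge> 0"
  unfolding abs_char_poly_def poly_altdef
  by (intro sum_nonneg) (simp add: assms coeff_map_poly)

text \<open>The initial value \<open>d 0\<close> may vanish because the determinants are started at
  equal indices. The induction therefore carries a weak and a strict inequality for consecutive
  terms.\<close>

lemma fibonacci_rec_pos:
  fixes d :: "nat \<Rightarrow> real"
  assumes rec: "\<And>k. d (Suc (Suc k)) = x * d (Suc k) + d k" and "x > 0" "d 0 \<ge> 0" "d 1 > 0"
  shows "d (Suc k) > 0"
proof -
  have "d k \<ge> 0 \<and> d (Suc k) > 0"
    using assms(2-) by (induction k) (auto simp: rec intro!: add_pos_nonneg)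
  then show ?thesis ..
qed

theorem theorem3p1:
  fixes G :: "'a pair_pre_digraph" and H :: "'b pair_pre_digraph"
    and e :: "'a \<times> 'a" and e' :: "'b \<times> 'b"
    and n :: nat and g h :: "nat \<Rightarrow> real poly"
  assumes "pair_graph G" and "pair_graph H"
    and "bipartite G" and "bipartite H"
    and "card (pverts G) = n" and "card (pverts H) = n"
    and "cut_edge G e" and "cut_edge H e'"
    and "\<And>k. g k = abs_char_poly (k_subdivision G e k)"
    and "\<And>k. h k = abs_char_poly (k_subdivision H e' k)"
  shows "((\<forall>x>0. poly (h 1) x * poly (g 0) x - poly (h 0) x * poly (g 1) x > 0) \<longrightarrow>
      (\<forall>k>0. energy (k_subdivision H e' k) - energy (k_subdivision G e k) >
             energy (k_subdivision H e' 0) - energy (k_subdivision G e 0))) \<and>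
    ((\<forall>x>0. poly (h 1) x * poly (g 0) x - poly (h 0) x * poly (g 1) x < 0) \<longrightarrow>
      (\<forall>k. k \<noteq> 1 \<longrightarrow> energy (k_subdivision H e' k) - energy (k_subdivision G e k) >
             energy (k_subdivision H e' 1) - energy (k_subdivision G e 1)))"
proof -
  obtain M where M: "\<And>k. size (M k) = n + k"
    "\<And>k. energy (k_subdivision G e k) = (\<Sum>r\<in>#M k. \<bar>r\<bar>)"
    "\<And>k x. (poly (g k) x)\<^sup>2 = (\<Prod>r\<in>#M k. x\<^sup>2 + r\<^sup>2)"
    "\<And>k x. poly (g (Suc (Suc k))) x = x * poly (g (Suc k)) x + poly (g k) x"
    using k_subdivision_spectra[OF assms(1,3,7)] unfolding assms(5) assms(9)[symmetric] by blast
  obtain N where N: "\<And>k. size (N k) = n + k"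
    "\<And>k. energy (k_subdivision H e' k) = (\<Sum>r\<in>#N k. \<bar>r\<bar>)"
    "\<And>k x. (poly (h k) x)\<^sup>2 = (\<Prod>r\<in>#N k. x\<^sup>2 + r\<^sup>2)"
    "\<And>k x. poly (h (Suc (Suc k))) x = x * poly (h (Suc k)) x + poly (h k) x"
    using k_subdivision_spectra[OF assms(2,4,8)] unfolding assms(6) assms(10)[symmetric] by blast
  have nonneg: "poly (g k) x \<ge> 0" "poly (h k) x \<ge> 0" if "x > 0" for k x
    using that by (simp_all add: assms(9,10) poly_abs_char_poly_nonneg)
  define d where "d j k x = poly (h k) x * poly (g j) x - poly (h j) x * poly (g k) x" for j k x
  have d_rec: "d j (Suc (Suc k)) x = x * d j (Suc k) x + d j k x" for j k x
    unfolding d_def M(4)[of k] N(4)[of k] by (simp add: algebra_simps)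
  have energy_less: "energy (k_subdivision H e' k) - energy (k_subdivision G e k) >
      energy (k_subdivision H e' j) - energy (k_subdivision G e j)"
    if pos: "\<And>x. x > 0 \<Longrightarrow> d j k x > 0" for j k
  proof -
    \<comment> \<open>Moving terms across makes this an inequality between sums of energies. Both
      joined multisets have \<open>n + j + n + k\<close> elements, as \<open>sum_abs_less\<close>
      demands.\<close>
    have "(\<Sum>r\<in>#N j + M k. \<bar>r\<bar>) < (\<Sum>r\<in>#N k + M j. \<bar>r\<bar>)"
    proof (rule sum_abs_less)
      fix x :: real assume "x > 0"
      then have "poly (h j) x * poly (g k) x < poly (h k) x * poly (g j) x"
        using pos by (simp add: d_def)
      \<comment> \<open>Only the squares are known as products over the spectra; squaring preserves
        the inequality between nonnegative values.\<close>
      then have "(poly (h j) x * poly (g k) x)\<^sup>2 < (poly (h k) x * poly (g j) x)\<^sup>2"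
        using nonneg[OF \<open>x > 0\<close>] by (intro power_strict_mono) simp_all
      then show "(\<Prod>r\<in>#N j + M k. x\<^sup>2 + r\<^sup>2) < (\<Prod>r\<in>#N k + M j. x\<^sup>2 + r\<^sup>2)"
        by (simp add: power_mult_distrib M(3) N(3))
    qed (simp add: M N)
    then show ?thesis
      by (simp add: M(2) N(2))
  qed
  show ?thesis
  proof (intro conjI impI allI)
    fix k :: nat
    assume pos: "\<forall>x>0. poly (h 1) x * poly (g 0) x - poly (h 0) x * poly (g 1) x > 0" and "k > 0"
    then obtain m where k: "k = Suc m"
      using gr0_conv_Suc by blast
    show "energy (k_subdivision H e' k) - energy (k_subdivision G e k) >
        energy (k_subdivision H e' 0) - energy (k_subdivision G e 0)"
    proof (rule energy_less)
      fix x :: real assume "x > 0"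
      then show "d 0 k x > 0"
        unfolding k using pos by (intro fibonacci_rec_pos[of "\<lambda>k. d 0 k x" x] d_rec) (auto simp: d_def)
    qed
  next
    fix k :: nat
    assume neg: "\<forall>x>0. poly (h 1) x * poly (g 0) x - poly (h 0) x * poly (g 1) x < 0" and "k \<noteq> 1"
    show "energy (k_subdivision H e' k) - energy (k_subdivision G e k) >
        energy (k_subdivision H e' 1) - energy (k_subdivision G e 1)"
    proof (rule energy_less)
      fix x :: real assume "x > 0"
      \<comment> \<open>Exchanging the indices changes the sign of the determinant, so the negative
        hypothesis becomes a positive value relative to index 1.\<close>
      then have d: "d 1 0 x > 0" "d 1 1 x = 0"
        using neg by (auto simp: d_def)
      show "d 1 k x > 0"
      proof (cases "k = 0")
        case False
        with \<open>k \<noteq> 1\<close> obtain m where k: "k = Suc (Suc m)"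
          by (metis One_nat_def not0_implies_Suc)
        \<comment> \<open>The sequence is shifted to start at \<open>d 1 1 x = 0\<close>; its next
          term \<open>d 1 2 x\<close> equals \<open>d 1 0 x\<close> and is positive.\<close>
        show ?thesis
          unfolding k using d \<open>x > 0\<close>
          by (intro fibonacci_rec_pos[of "\<lambda>k. d 1 (Suc k) x" x] d_rec) (auto simp: d_rec[of _ 0])
      qed (use d in simp)
    qed
  qed
qed

end
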